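(* Let $m,a,g,\rho,\sigma>0$ and $\gamma\in[0,\pi]$ be fixed constants, and let the height of the center $h(\phi_0)$, the total energy $E_T(\phi_0)$ and the total force $F_T(\phi_0)$ be the functions of $\phi_0\in[0,\pi]$ given in the context. Then for every $\phi_0\in[0,\pi]$, excluding the cases $\phi_0=\gamma=0$ and $\phi_0=\gamma=\pi$, $$-\frac{dE_T}{dh}=-\frac{dE_T}{d\phi_0}\,\frac{d\phi_0}{dh}=F_T(\phi_0),$$ where $\frac{d\phi_0}{dh}=\left(\frac{dh}{d\phi_0}\right)^{-1}$.
   Context: A horizontal circular cylinder of radius $a$ floats on an unbounded bath. Considered per unit length, it has mass $m$; $g$ is the gravitational acceleration, $\rho$ the density difference between fluid and air, $\sigma$ the surface tension, $\gamma$ the contact angle, and $\phi_0\in[0,\pi]$ the wetting angle. The following functions of $\phi_0$ are used. Height of the center of the cylinder relative to the undisturbed fluid level: $$h(\phi_0)=a\cos\phi_0+2\sqrt{\frac{\sigma}{\rho g}}\cos\left(\frac{\phi_0+\gamma}{2}\right),$$ for which $\frac{dh}{d\phi_0}<0$ on $[0,\pi]$ except when $\phi_0=\gamma=0$ or $\phi_0=\gamma=\pi$; thus $E_T$ may be regarded as a function of $h$. Total energy (relative to the undisturbed state; sum of body potential energy, wetting energy, surface energy and fluid potential energy): $$\begin{aligned}E_T(\phi_0)={}& mg\left[a\cos\phi_0+2\sqrt{\tfrac{\sigma}{\rho g}}\cos\left(\tfrac{\phi_0+\gamma}{2}\right)\right]-2\sigma a\phi_0\cos\gamma+\tfrac{8}{3}\sigma\sqrt{\tfrac{\sigma}{\rho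 g}}\left[1-\sin^3\left(\tfrac{\phi_0+\gamma}{2}\right)\right]\\&+2\sigma a\sin\phi_0\cos(\phi_0+\gamma)+\tfrac{1}{12}\rho g a^3\sin 3\phi_0-\rho g a^3\phi_0\cos\phi_0+\tfrac34\rho g a^3\sin\phi_0\\&+a^2\sqrt{\sigma\rho g}\cos\left(\tfrac{\phi_0+\gamma}{2}\right)\sin 2\phi_0-2a^2\sqrt{\sigma\rho g}\,\phi_0\cos\left(\tfrac{\phi_0+\gamma}{2}\right).\end{aligned}$$ Total vertical force, upward positive (sum of gravitational, surface tension and buoyant forces): $$F_T(\phi_0)=-mg-2\sigma\sin(\phi_0+\gamma)-4a\sqrt{\sigma\rho g}\cos\left(\tfrac{\phi_0+\gamma}{2}\right)\sin\phi_0-\tfrac12\rho g a^2\sin 2\phi_0+\rho g a^2\phi_0.$$ *)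

theory Defs
  imports "HOL-Analysis.Analysis"
begin

text \<open>A horizontal cylinder floating on an unbounded bath, per unit length: mass \<open>m\<close>, radius \<open>a\<close>,
  gravitational acceleration \<open>g\<close>, density difference between fluid and air \<open>\<rho>\<close>, surface tension
  \<open>\<sigma>\<close>, contact angle \<open>\<gamma>\<close>, wetting angle \<open>\<phi>\<close> in \<open>{0..pi}\<close>. Heights and energies are relative to
  the undisturbed state, forces are positive upward.\<close>

definition cyl_height :: "real \<Rightarrow> real \<Rightarrow> real \<Rightarrow> real \<Rightarrow> real \<Rightarrow> real \<Rightarrow> real" where
  "cyl_height a g \<rho> \<sigma> \<gamma> \<phi> =
     a * cos \<phi> + 2 * sqrt (\<sigma> / (\<rho> * g)) * cos ((\<phi> + \<gamma>) / 2)"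

definition total_energy ::
    "real \<Rightarrow> real \<Rightarrow> real \<Rightarrow> real \<Rightarrow> real \<Rightarrow> real \<Rightarrow> real \<Rightarrow> real" where
  "total_energy m a g \<rho> \<sigma> \<gamma> \<phi> =
     m * g * (a * cos \<phi> + 2 * sqrt (\<sigma> / (\<rho> * g)) * cos ((\<phi> + \<gamma>) / 2))
     - 2 * \<sigma> * a * \<phi> * cos \<gamma>
     + 8 / 3 * \<sigma> * sqrt (\<sigma> / (\<rho> * g)) * (1 - sin ((\<phi> + \<gamma>) / 2) ^ 3)
     + 2 * \<sigma> * a * sin \<phi> * cos (\<phi> + \<gamma>)
     + 1 / 12 * \<rho> * g * a ^ 3 * sin (3 * \<phi>)
     - \<rho> * g * a ^ 3 * \<phi> * cos \<phi>
     + 3 / 4 * \<rho> * g * a ^ 3 * sin \<phi>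
     + a ^ 2 * sqrt (\<sigma> * \<rho> * g) * cos ((\<phi> + \<gamma>) / 2) * sin (2 * \<phi>)
     - 2 * a ^ 2 * sqrt (\<sigma> * \<rho> * g) * \<phi> * cos ((\<phi> + \<gamma>) / 2)"

definition total_force ::
    "real \<Rightarrow> real \<Rightarrow> real \<Rightarrow> real \<Rightarrow> real \<Rightarrow> real \<Rightarrow> real \<Rightarrow> real" where
  "total_force m a g \<rho> \<sigma> \<gamma> \<phi> =
     - m * g
     - 2 * \<sigma> * sin (\<phi> + \<gamma>)
     - 4 * a * sqrt (\<sigma> * \<rho> * g) * cos ((\<phi> + \<gamma>) / 2) * sin \<phi>
     - 1 / 2 * \<rho> * g * a ^ 2 * sin (2 * \<phi>)
     + \<rho> * g * a ^ 2 * \<phi>"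

text \<open>The wetting angle as a function of the height of the center. It is meaningful only on
  the image of \<open>{0..pi}\<close> under the height, and because the height is injective there.\<close>

definition angle_of_height ::
    "real \<Rightarrow> real \<Rightarrow> real \<Rightarrow> real \<Rightarrow> real \<Rightarrow> real \<Rightarrow> real" where
  "angle_of_height a g \<rho> \<sigma> \<gamma> = the_inv_into {0..pi} (cyl_height a g \<rho> \<sigma> \<gamma>)"

definition energy_of_height ::
    "real \<Rightarrow> real \<Rightarrow> real \<Rightarrow> real \<Rightarrow> real \<Rightarrow> real \<Rightarrow> real \<Rightarrow> real" where
  "energy_of_height m a g \<rho> \<sigma> \<gamma> y =
     total_energy m a g \<rho> \<sigma> \<gamma> (angle_of_height a g \<rho> \<sigma> \<gamma> y)"

end

theory Submission
  imports Defs
begin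

text \<open>The total force is conservative along the family of equilibrium menisci: differentiating
  the energy in \<phi> gives exactly minus the force times dh/d\<phi>
  (\<open>total_energy_has_real_derivative\<close>), a trigonometric identity. The height is
  strictly decreasing in \<phi> (\<open>inj_on_cyl_height\<close>), and its slope is nonzero outside
  the two excluded cases (\<open>cyl_height_derivative_neg\<close>), so the inverse function rule
  and the chain rule let that factor cancel. Derivatives are taken within [0, pi] and its image
  under the height, so the endpoints are covered as one-sided derivatives.\<close>

text \<open>Compactness makes the inverse of a continuous injection continuous, and continuity of
  the inverse at the image point is what the inverse rule within a set requires.\<close>

lemma has_real_derivative_the_inv_into:
  fixes f :: "real \<Rightarrow> real"
  assumes "compact S" "continuous_on S f" "inj_on f S" "x \<in> S"
    and f: "(f has_real_derivative D) (at x within S)" and "D \<noteq> 0"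
  shows "(the_inv_into S f has_real_derivative inverse D) (at (f x) within f ` S)"
  unfolding has_field_derivative_def
proof (rule has_derivative_inverse_within)
  show "(f has_derivative (*) D) (at x within S)"
    using f by (simp add: has_field_derivative_def)
  show "continuous (at (f x) within f ` S) (the_inv_into S f)"
    using continuous_on_inv_into[OF assms(2,1,3)] \<open>x \<in> S\<close>
    by (auto simp: continuous_on_eq_continuous_within)
  show "linear ((*) (inverse D))"
    by (simp add: linear_times)
  show "(*) (inverse D) \<circ> (*) D = id"
    using \<open>D \<noteq> 0\<close> by (auto simp: fun_eq_iff)
qed (use assms in \<open>auto simp: the_inv_into_f_f\<close>)

lemma cyl_height_has_real_derivative:
  "(cyl_height a g \<rho> \<sigma> \<gamma> has_real_derivative
      - a * sin \<phi> - sqrt (\<sigma> / (\<rho> * g)) * sin ((\<phi> + \<gamma>) / 2)) (at \<phi> within S)"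
  unfolding cyl_height_def[abs_def]
  by (auto intro!: derivative_eq_intros)

lemma continuous_on_cyl_height: "continuous_on S (cyl_height a g \<rho> \<sigma> \<gamma>)"
  using cyl_height_has_real_derivative
  by (metis DERIV_continuous continuous_on_eq_continuous_within)

text \<open>Both cosine arguments stay in [0, pi]. The term in cos \<phi> decreases strictly and the
  capillary term weakly, so injectivity survives the points where the slope vanishes.\<close>

lemma inj_on_cyl_height:
  assumes "a > 0" "g > 0" "\<rho> > 0" "\<sigma> > 0" "\<gamma> \<in> {0..pi}"
  shows "inj_on (cyl_height a g \<rho> \<sigma> \<gamma>) {0..pi}"
proof -
  have "cyl_height a g \<rho> \<sigma> \<gamma> y < cyl_height a g \<rho> \<sigma> \<gamma> x"
    if "x \<in> {0..pi}" "y \<in> {0..pi}" "x < y" for x y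
  proof -
    have "a * cos y < a * cos x"
      using that \<open>a > 0\<close> by (simp add: cos_monotone_0_pi)
    moreover have "cos ((y + \<gamma>) / 2) \<le> cos ((x + \<gamma>) / 2)"
      using that assms(5) by (intro cos_monotone_0_pi_le) auto
    then have "2 * sqrt (\<sigma> / (\<rho> * g)) * cos ((y + \<gamma>) / 2)
        \<le> 2 * sqrt (\<sigma> / (\<rho> * g)) * cos ((x + \<gamma>) / 2)"
      using assms by (intro mult_left_mono) auto
    ultimately show ?thesis
      by (simp add: cyl_height_def)
  qed
  then show ?thesis
    by (metis linorder_inj_onI' less_irrefl)
qed

lemma cyl_height_derivative_neg:
  assumes "a > 0" "g > 0" "\<rho> > 0" "\<sigma> > 0" "\<gamma> \<in> {0..pi}" "\<phi> \<in> {0..pi}"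
    and "\<not> (\<phi> = 0 \<and> \<gamma> = 0)" "\<not> (\<phi> = pi \<and> \<gamma> = pi)"
  shows "- a * sin \<phi> - sqrt (\<sigma> / (\<rho> * g)) * sin ((\<phi> + \<gamma>) / 2) < 0"
proof -
  \<comment> \<open>The half-sum lies strictly between 0 and pi precisely because the two degenerate
    cases are excluded.\<close>
  have "sin ((\<phi> + \<gamma>) / 2) > 0"
    using assms by (intro sin_gt_zero) auto
  then have "sqrt (\<sigma> / (\<rho> * g)) * sin ((\<phi> + \<gamma>) / 2) > 0"
    using assms by simp
  moreover have "a * sin \<phi> \<ge> 0"
    using assms by (simp add: sin_ge_zero)
  ultimately show ?thesis
    by simp
qed

lemma total_energy_has_real_derivative:
  assumes "g > 0" "\<rho> > 0" "\<sigma> > 0"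
  shows "(total_energy m a g \<rho> \<sigma> \<gamma> has_real_derivative
      - total_force m a g \<rho> \<sigma> \<gamma> \<phi> *
        (- a * sin \<phi> - sqrt (\<sigma> / (\<rho> * g)) * sin ((\<phi> + \<gamma>) / 2))) (at \<phi> within S)"
proof -
  \<comment> \<open>With the capillary length \<open>L\<close> and \<open>K = \<rho> g\<close>, both square roots and \<open>\<sigma>\<close> are monomials in \<open>K\<close> and
    \<open>L\<close>, so that the claim becomes a polynomial identity in the sines and cosines of \<open>\<phi>\<close> and \<open>\<psi>\<close>.\<close>
  define L where "L = sqrt (\<sigma> / (\<rho> * g))"
  define K where "K = \<rho> * g"
  have \<sigma>: "\<sigma> = K * L\<^sup>2"
    using assms by (simp add: L_def K_def)
  have "\<sigma> * \<rho> * g = (K * L)\<^sup>2"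
    unfolding \<sigma> by (simp add: K_def power2_eq_square)
  moreover have "K * L \<ge> 0"
    using assms by (simp add: K_def L_def)
  ultimately have root: "sqrt (\<sigma> * \<rho> * g) = K * L"
    by simp
  define \<psi> where "\<psi> = (\<phi> + \<gamma>) / 2"
  have \<psi>: "2 * \<psi> = \<phi> + \<gamma>"
    by (simp add: \<psi>_def)
  \<comment> \<open>The termwise derivative, with the product rule applied and terms grouped by
    physical coefficient, before any trigonometric identity is used.\<close>
  define D where "D = - m * g * (a * sin \<phi> + L * sin \<psi>) - 2 * \<sigma> * a * cos \<gamma>
     - 4 * \<sigma> * L * (sin \<psi>)\<^sup>2 * cos \<psi>
     + 2 * \<sigma> * a * (cos \<phi> * cos (\<phi> + \<gamma>) - sin \<phi> * sin (\<phi> + \<gamma>))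
     + K * a ^ 3 * (1 / 4 * cos (3 * \<phi>) - 1 / 4 * cos \<phi> + \<phi> * sin \<phi>)
     + a\<^sup>2 * (K * L) * (2 * cos \<psi> * cos (2 * \<phi>) - 1 / 2 * sin \<psi> * sin (2 * \<phi>))
     - a\<^sup>2 * (K * L) * (2 * cos \<psi> - \<phi> * sin \<psi>)"
  have deriv: "(total_energy m a g \<rho> \<sigma> \<gamma> has_real_derivative D) (at \<phi> within S)"
    unfolding total_energy_def[abs_def] L_def[symmetric] root
    apply (rule derivative_eq_intros refl numeral_neq_zero)+
    apply (simp only: D_def \<psi>_def[symmetric] K_def)
    apply (simp add: power2_eq_square power3_eq_cube)
    apply (simp add: algebra_simps)
    done
  \<comment> \<open>The first identity produces a cos \<gamma> that cancels the wetting term of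
    \<open>D\<close>, leaving \<gamma> only inside \<psi>. With double angles expanded as well, the
    two sides agree as polynomials, without further use of the Pythagorean relation.\<close>
  have trig: "cos \<phi> * cos (\<phi> + \<gamma>) - sin \<phi> * sin (\<phi> + \<gamma>) = cos \<gamma> - 2 * sin \<phi> * sin (\<phi> + \<gamma>)"
      "sin (\<phi> + \<gamma>) = 2 * sin \<psi> * cos \<psi>"
      "cos (3 * \<phi>) = cos \<phi> - 4 * cos \<phi> * (sin \<phi>)\<^sup>2"
    subgoal using cos_diff[of "\<phi> + \<gamma>" \<phi>] by simp
    subgoal using sin_double[of \<psi>] \<psi> by simp
    subgoal unfolding cos_treble_cos sin_squared_eq by algebra
    done
  have "D = - total_force m a g \<rho> \<sigma> \<gamma> \<phi> * (- a * sin \<phi> - L * sin \<psi>)"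
    unfolding D_def total_force_def root \<psi>_def[symmetric] trig(1)
    unfolding trig(2,3) cos_double_sin sin_double
    \<comment> \<open>Writing \<sigma> through \<open>L\<close> matches the surface term in sin
      \<phi> sin \<psi> cos \<psi> with the cross product of the square-root term of the force and
      the capillary part of the slope.\<close>
    unfolding \<sigma> K_def
    by (simp add: power2_eq_square power3_eq_cube algebra_simps)
  with deriv show ?thesis
    by (simp add: L_def \<psi>_def)
qed

theorem mainTheorem1:
  fixes m a g \<rho> \<sigma> \<gamma> \<phi>\<^sub>0 :: real
  assumes "m > 0" "a > 0" "g > 0" "\<rho> > 0" "\<sigma> > 0"
    and "\<gamma> \<in> {0..pi}"
    and "\<phi>\<^sub>0 \<in> {0..pi}"
    and "\<not> (\<phi>\<^sub>0 = 0 \<and> \<gamma> = 0)"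
    and "\<not> (\<phi>\<^sub>0 = pi \<and> \<gamma> = pi)"
  shows "inj_on (cyl_height a g \<rho> \<sigma> \<gamma>) {0..pi} \<and>
    (\<exists>dh_d\<phi> dE_d\<phi> d\<phi>_dh dE_dh.
       (cyl_height a g \<rho> \<sigma> \<gamma> has_real_derivative dh_d\<phi>) (at \<phi>\<^sub>0 within {0..pi}) \<and>
       dh_d\<phi> \<noteq> 0 \<and>
       (total_energy m a g \<rho> \<sigma> \<gamma> has_real_derivative dE_d\<phi>) (at \<phi>\<^sub>0 within {0..pi}) \<and>
       (angle_of_height a g \<rho> \<sigma> \<gamma> has_real_derivative d\<phi>_dh)
         (at (cyl_height a g \<rho> \<sigma> \<gamma> \<phi>\<^sub>0) within cyl_height a g \<rho> \<sigma> \<gamma> ` {0..pi}) \<and>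
       d\<phi>_dh = inverse dh_d\<phi> \<and>
       (energy_of_height m a g \<rho> \<sigma> \<gamma> has_real_derivative dE_dh)
         (at (cyl_height a g \<rho> \<sigma> \<gamma> \<phi>\<^sub>0) within cyl_height a g \<rho> \<sigma> \<gamma> ` {0..pi}) \<and>
       - dE_dh = - dE_d\<phi> * d\<phi>_dh \<and>
       - dE_d\<phi> * d\<phi>_dh = total_force m a g \<rho> \<sigma> \<gamma> \<phi>\<^sub>0)"
proof -
  let ?S = "{0..pi}" and ?h = "cyl_height a g \<rho> \<sigma> \<gamma>" and ?F = "total_force m a g \<rho> \<sigma> \<gamma> \<phi>\<^sub>0"
  define H where "H = - a * sin \<phi>\<^sub>0 - sqrt (\<sigma> / (\<rho> * g)) * sin ((\<phi>\<^sub>0 + \<gamma>) / 2)"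
  have inj: "inj_on ?h ?S"
    using assms by (intro inj_on_cyl_height)
  have "H < 0"
    unfolding H_def using assms by (intro cyl_height_derivative_neg)
  then have "H \<noteq> 0"
    by simp
  have h: "(?h has_real_derivative H) (at \<phi>\<^sub>0 within ?S)"
    unfolding H_def by (rule cyl_height_has_real_derivative)
  have E: "(total_energy m a g \<rho> \<sigma> \<gamma> has_real_derivative - ?F * H) (at \<phi>\<^sub>0 within ?S)"
    unfolding H_def using assms by (intro total_energy_has_real_derivative)
  have angle: "(angle_of_height a g \<rho> \<sigma> \<gamma> has_real_derivative inverse H) (at (?h \<phi>\<^sub>0) within ?h ` ?S)"
    unfolding angle_of_height_def
    using assms(7) inj h \<open>H \<noteq> 0\<close>
    by (intro has_real_derivative_the_inv_into continuous_on_cyl_height) auto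
  have image: "angle_of_height a g \<rho> \<sigma> \<gamma> ` ?h ` ?S = ?S"
    unfolding angle_of_height_def using inj by (rule the_inv_into_onto)
  have value_at: "angle_of_height a g \<rho> \<sigma> \<gamma> (?h \<phi>\<^sub>0) = \<phi>\<^sub>0"
    unfolding angle_of_height_def using inj assms(7) by (rule the_inv_into_f_f)
  have "(total_energy m a g \<rho> \<sigma> \<gamma> \<circ> angle_of_height a g \<rho> \<sigma> \<gamma> has_real_derivative
      - ?F * H * inverse H) (at (?h \<phi>\<^sub>0) within ?h ` ?S)"
    using E angle by (intro DERIV_image_chain) (simp_all only: image value_at)
  then have "(energy_of_height m a g \<rho> \<sigma> \<gamma> has_real_derivative - ?F * H * inverse H)
      (at (?h \<phi>\<^sub>0) within ?h ` ?S)"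
    by (simp only: energy_of_height_def[abs_def] comp_def)
  moreover have "- (- ?F * H) * inverse H = ?F"
    using \<open>H \<noteq> 0\<close> by simp
  ultimately show ?thesis
    using inj h E angle \<open>H \<noteq> 0\<close>
    by (intro conjI exI[of _ H] exI[of _ "- ?F * H"] exI[of _ "inverse H"]
        exI[of _ "- ?F * H * inverse H"]) simp_all
qed

end
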